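(* Let $n\ge 1$ be an integer and for $0\le i\le n$ let $\lambda_i=2^n(n-i)-n$ (the eigenvalues of the Hamming graph $H(n,2^n)$, with multiplicity $\binom{n}{i}(2^n-1)^i$). Then the spectrum of the extended Hamming graph $EH(n,2^n)$ is the multiset obtained by taking, for each pair of integers $(i,t)$ with $0\le i\le n$ and $0\le t\le i$, the value $$\theta_{i,t}=\lambda_i+(-1)^t$$ with multiplicity $$m(\theta_{i,t})=\binom{n}{i}\binom{i}{t}\,2^{(n-1)t}\,(2^{n-1}-1)^{i-t}$$ (multiplicities of coinciding values being added, and with the convention $0^0=1$).
   Context: Let $\Omega=\{0,1,\dots,2^n-1\}$. The Hamming graph $H(n,2^n)$ has vertex set $\Omega^n$, two $n$-tuples being adjacent if and only if they differ in exactly one coordinate. For $u=(u_1,\dots,u_n)\in\Omega^n$ define its complement $u^c=(2^n-1-u_1,\dots,2^n-1-u_n)$. The extended Hamming graph $EH(n,2^n)$ has vertex set $\Omega^n$ and edge set $E(H(n,2^n))\cup\{\{u,u^c\} : u\in\Omega^n,\ u\neq u^c\}$. The spectrum of a graph is the multiset of eigenvalues of its adjacency matrix.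
   Formalization: For n=1 the claim fails: EH(1,2) is K_2 with spectrum {1,-1}, while the formula gives {2,-2}. The formal theorem states it for n≥2, and for all n≥1 when the complement edges are counted as additional (parallel) edges. *)

theory Defs
  imports
    "Jordan_Normal_Form.Char_Poly"
    "HOL-Computational_Algebra.Polynomial"
    "HOL-Computational_Algebra.Fundamental_Theorem_Algebra"
    "HOL-Library.Multiset"
begin

text \<open>Vertices are \<open>n\<close>-tuples over \<open>{0, \<dots>, 2 ^ n - 1}\<close>, as lists of length \<open>n\<close>;
  an edge is the set of its two end points.\<close>

definition hamming_verts :: "nat \<Rightarrow> nat list set" where
  "hamming_verts n = {u. length u = n \<and> set u \<subseteq> {0..<2 ^ n}}"

definition hamming_edges :: "nat \<Rightarrow> nat list set set" where
  "hamming_edges n = {{u, v} |u v. u \<in> hamming_verts n \<and> v \<in> hamming_verts n \<and>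
     card {k. k < n \<and> u ! k \<noteq> v ! k} = 1}"

definition compl_vert :: "nat \<Rightarrow> nat list \<Rightarrow> nat list" where
  "compl_vert n u = map (\<lambda>x. 2 ^ n - 1 - x) u"

definition compl_edges :: "nat \<Rightarrow> nat list set set" where
  "compl_edges n = {{u, compl_vert n u} |u. u \<in> hamming_verts n \<and> u \<noteq> compl_vert n u}"

definition ext_hamming_edges :: "nat \<Rightarrow> nat list set set" where
  "ext_hamming_edges n = hamming_edges n \<union> compl_edges n"

text \<open>For \<open>n \<ge> 2\<close> the two families of edges are disjoint. For \<open>n = 1\<close> they coincide; the
  following version keeps both copies, as parallel edges.\<close>

definition ext_hamming_multi_edges :: "nat \<Rightarrow> nat list set multiset" where
  "ext_hamming_multi_edges n = mset_set (hamming_edges n) + mset_set (compl_edges n)"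

text \<open>The rows and columns of an adjacency matrix are indexed by a list \<open>vs\<close> that enumerates the
  vertices without repetition. In a multigraph an entry counts the parallel edges.\<close>

definition graph_adj_mat :: "'v list \<Rightarrow> 'v set set \<Rightarrow> complex mat" where
  "graph_adj_mat vs E = mat (length vs) (length vs)
     (\<lambda>(i, j). if {vs ! i, vs ! j} \<in> E then 1 else 0)"

definition multigraph_adj_mat :: "'v list \<Rightarrow> 'v set multiset \<Rightarrow> complex mat" where
  "multigraph_adj_mat vs E = mat (length vs) (length vs)
     (\<lambda>(i, j). of_nat (count E {vs ! i, vs ! j}))"

text \<open>Eigenvalues with algebraic multiplicity: the roots of the characteristic polynomial over the
  complex numbers.\<close>

definition mat_spectrum :: "complex mat \<Rightarrow> complex multiset" where
  "mat_spectrum A = proots (char_poly A)"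

definition hamming_ev :: "nat \<Rightarrow> nat \<Rightarrow> complex" where
  "hamming_ev n i = 2 ^ n * (of_nat n - of_nat i) - of_nat n"

definition ext_hamming_ev :: "nat \<Rightarrow> nat \<Rightarrow> nat \<Rightarrow> complex" where
  "ext_hamming_ev n i t = hamming_ev n i + (- 1) ^ t"

definition ext_hamming_mult :: "nat \<Rightarrow> nat \<Rightarrow> nat \<Rightarrow> nat" where
  "ext_hamming_mult n i t =
     (n choose i) * (i choose t) * 2 ^ ((n - 1) * t) * (2 ^ (n - 1) - 1) ^ (i - t)"

end

theory Submission
  imports Defs
begin

text \<open>The Walsh functions on \<open>{0, \<dots>, 2 ^ n - 1}\<close> (with numbers read as bit vectors) are
  orthogonal characters. Complementing a number flips all its bits, so each of them is multiplied by
  a sign under the complement. Their \<open>n\<close>-fold tensor products, indexed by vertices \<open>w\<close>, are therefore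
  common eigenvectors of the Hamming graph and of the complement matching. If \<open>i\<close> entries of \<open>w\<close> are
  nonzero and \<open>t\<close> entries have sign \<open>-1\<close>, the eigenvalue is \<open>\<lambda>\<^sub>i + (-1) ^ t\<close>. Among the numbers below
  \<open>2 ^ n\<close>, half have sign \<open>-1\<close> because the sum of the signs is an inner product of two distinct Walsh functions,
  and \<open>0\<close> has sign \<open>1\<close>; this gives the multiplicities.\<close>

section \<open>Spectrum of a matrix with an explicit eigenbasis\<close>

text \<open>The columns of \<open>P\<close> are eigenvectors and \<open>Q\<close> inverts
  \<open>P\<close>, so \<open>A\<close> is similar to the diagonal matrix \<open>D\<close>. Entries
  are functions of vertices, which keeps the enumeration order out of the hypotheses.\<close>

lemma char_poly_eigenbasis:
  fixes a p q :: "'v \<Rightarrow> 'v \<Rightarrow> 'a :: field"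
  assumes "distinct vs"
    and inv: "\<And>u w. u \<in> set vs \<Longrightarrow> w \<in> set vs \<Longrightarrow>
      (\<Sum>v\<in>set vs. p u v * q v w) = of_bool (u = w)"
    and eig: "\<And>u w. u \<in> set vs \<Longrightarrow> w \<in> set vs \<Longrightarrow>
      (\<Sum>v\<in>set vs. a u v * p v w) = \<theta> w * p u w"
  shows "char_poly (mat (length vs) (length vs) (\<lambda>(i, j). a (vs ! i) (vs ! j))) =
    (\<Prod>v\<leftarrow>vs. [:- \<theta> v, 1:])"
proof -
  let ?N = "length vs"
  define A where "A = mat ?N ?N (\<lambda>(i, j). a (vs ! i) (vs ! j))"
  define P where "P = mat ?N ?N (\<lambda>(i, j). p (vs ! i) (vs ! j))"
  define Q where "Q = mat ?N ?N (\<lambda>(i, j). q (vs ! i) (vs ! j))"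
  define D where "D = mat ?N ?N (\<lambda>(i, j). if i = j then \<theta> (vs ! i) else 0)"
  have carr: "A \<in> carrier_mat ?N ?N" "P \<in> carrier_mat ?N ?N" "Q \<in> carrier_mat ?N ?N"
    "D \<in> carrier_mat ?N ?N"
    by (simp_all add: A_def P_def Q_def D_def)
  have sum_nth: "(\<Sum>k = 0..<?N. f (vs ! k)) = (\<Sum>v\<in>set vs. f v)" for f :: "'v \<Rightarrow> 'a"
    using sum_list_distinct_conv_sum_set[OF \<open>distinct vs\<close>, of f] sum_list_sum_nth[of "map f vs"]
    by simp
  have PQ: "P * Q = 1\<^sub>m ?N"
    by (rule eq_matI)
      (auto simp: P_def Q_def scalar_prod_def sum_nth[of "\<lambda>v. p _ v * q v _"] inv
        nth_eq_iff_index_eq[OF \<open>distinct vs\<close>])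
  have AP: "A * P = P * D"
    by (rule eq_matI)
      (auto simp: A_def P_def D_def scalar_prod_def sum_nth[of "\<lambda>v. a _ v * p v _"] eig
        if_distrib cong: if_cong)
  have "A = A * (P * Q)"
    using carr by (simp add: PQ)
  also have "\<dots> = P * D * Q"
    using carr AP by (simp flip: assoc_mult_mat)
  finally have "similar_mat A D"
    using PQ mat_mult_left_right_inverse[OF carr(2,3) PQ] carr
    by (intro similar_matI[of _ _ P Q ?N]) auto
  then have "char_poly A = char_poly D"
    by (rule char_poly_similar)
  also have "\<dots> = (\<Prod>x\<leftarrow>diag_mat D. [:- x, 1:])"
    by (rule char_poly_upper_triangular[OF carr(4)]) (auto simp: D_def)
  also have "diag_mat D = map \<theta> vs"
    by (rule nth_equalityI) (auto simp: diag_mat_def D_def)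
  finally show ?thesis
    by (simp add: A_def o_def)
qed

lemma proots_prod_linear_factors:
  fixes \<theta> :: "'v \<Rightarrow> 'a :: idom"
  shows "proots (\<Prod>v\<leftarrow>vs. [:- \<theta> v, 1:]) = image_mset \<theta> (mset vs)"
proof (induction vs)
  case (Cons v vs)
  \<comment> \<open>Additivity of \<open>proots\<close> under products requires nonzero
    factors.\<close>
  have "(\<Prod>v\<leftarrow>vs. [:- \<theta> v, 1:]) \<noteq> 0"
    by (auto simp: prod_list_zero_iff)
  then show ?case
    using Cons by (simp add: proots_mult del: mult_pCons_left)
qed simp

section \<open>Sums over tuples\<close>

lemma sum_lists_Suc:
  "(\<Sum>u\<in>{u. length u = Suc n \<and> set u \<subseteq> S}. f u) =
    (\<Sum>x\<in>S. \<Sum>u\<in>{u. length u = n \<and> set u \<subseteq> S}. f (x # u))"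
proof -
  have "{u. length u = Suc n \<and> set u \<subseteq> S} =
     (\<lambda>(x, u). x # u) ` (S \<times> {u. length u = n \<and> set u \<subseteq> S})"
    by (auto simp: length_Suc_conv image_iff)
  then have "(\<Sum>u\<in>{u. length u = Suc n \<and> set u \<subseteq> S}. f u) =
      (\<Sum>(x, u)\<in>S \<times> {u. length u = n \<and> set u \<subseteq> S}. f (x # u))"
    by (subst sum.reindex_cong[where l = "\<lambda>(x, u). x # u"]) (auto simp: inj_on_def)
  then show ?thesis
    by (simp add: sum.cartesian_product)
qed

text \<open>The distributive law: expanding a product of \<open>n\<close> sums chooses one summand
  per factor, that is, a tuple.\<close>

lemma sum_lists_prod:
  fixes f :: "nat \<Rightarrow> 'b \<Rightarrow> 'a :: comm_semiring_1"
  shows "(\<Sum>u\<in>{u. length u = n \<and> set u \<subseteq> S}. \<Prod>k<n. f k (u ! k)) = (\<Prod>k<n. \<Sum>x\<in>S. f k x)"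
proof (induction n arbitrary: f)
  case 0
  have "{u :: 'b list. length u = 0 \<and> set u \<subseteq> S} = {[]}" by auto
  then show ?case by simp
next
  case (Suc n)
  show ?case
    by (simp add: sum_lists_Suc prod.lessThan_Suc_shift Suc.IH[of "\<lambda>k. f (Suc k)"] del: prod.lessThan_Suc
        flip: sum_distrib_left sum_distrib_right)
qed

section \<open>Walsh functions\<close>

lemma sum_lessThan_double:
  "(\<Sum>y<2 * N. f y) = (\<Sum>y<N. f (2 * y) + f (2 * y + 1))"
  for N :: nat and f :: "nat \<Rightarrow> 'a :: comm_monoid_add"
  by (induction N) (auto simp: ac_simps)

text \<open>The sign is \<open>-1\<close> to the number of common one-bits among the lowest
  \<open>m\<close> bits: the entries of the Sylvester-Hadamard matrix of order \<open>2 ^ m\<close>.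
  The recursion strips the lowest bit.\<close>

fun walsh :: "nat \<Rightarrow> nat \<Rightarrow> nat \<Rightarrow> complex" where
  "walsh 0 x y = 1"
| "walsh (Suc m) x y = (if odd x \<and> odd y then -1 else 1) * walsh m (x div 2) (y div 2)"

lemma walsh_cases: "walsh m x y = 1 \<or> walsh m x y = -1"
proof (induction m arbitrary: x y)
  case (Suc m)
  from Suc.IH[of "x div 2" "y div 2"] show ?case by auto
qed simp

lemma walsh_0_left [simp]: "walsh m 0 y = 1"
  by (induction m arbitrary: y) auto

lemma walsh_0_right [simp]: "walsh m x 0 = 1"
  by (induction m arbitrary: x) auto

text \<open>The Hadamard matrix squares to \<open>2 ^ m\<close> times the identity. Splitting the
  sum by the lowest bit of \<open>y\<close> yields the factor \<open>1 + s\<close>, which vanishes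
  exactly when \<open>x\<close> and \<open>z\<close> have different parity.\<close>

lemma walsh_orthogonal:
  assumes "x < 2 ^ m" "z < 2 ^ m"
  shows "(\<Sum>y<2 ^ m. walsh m x y * walsh m y z) = 2 ^ m * of_bool (x = z)"
  using assms
proof (induction m arbitrary: x z)
  case (Suc m)
  define s where "s = (if odd x then -1 else 1) * (if odd z then -1 else 1 :: complex)"
  have "(\<Sum>y<2 ^ Suc m. walsh (Suc m) x y * walsh (Suc m) y z) =
      (\<Sum>y<2 ^ m. (1 + s) * (walsh m (x div 2) y * walsh m y (z div 2)))"
    unfolding power_Suc sum_lessThan_double by (rule sum.cong) (auto simp: s_def algebra_simps)
  also have "\<dots> = (1 + s) * (2 ^ m * of_bool (x div 2 = z div 2))"
    using Suc.prems by (subst Suc.IH[symmetric]) (auto simp: sum_distrib_left)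
  also have "\<dots> = 2 ^ Suc m * of_bool (x = z)"
  proof (cases "even x = even z")
    case True
    then have "x div 2 = z div 2 \<longleftrightarrow> x = z"
      by (metis bit_eq_rec)
    then show ?thesis using True by (auto simp: s_def)
  next
    case False
    then have "s = -1" "x \<noteq> z" by (auto simp: s_def)
    then show ?thesis by simp
  qed
  finally show ?case .
qed auto

text \<open>The number \<open>2 ^ m - 1\<close> has all bits set. Every one-bit of \<open>z\<close>
  meets a one-bit in exactly one of \<open>y\<close> and its complement, so their two signs multiply
  to the sign of the all-ones index.\<close>

lemma walsh_compl:
  "y < 2 ^ m \<Longrightarrow> walsh m (2 ^ m - 1 - y) z = walsh m (2 ^ m - 1) z * walsh m y z"
proof (induction m arbitrary: y z)
  case (Suc m)
  have "(2 ^ Suc m - 1 - y) div 2 = 2 ^ m - 1 - y div 2" "((2::nat) ^ Suc m - 1) div 2 = 2 ^ m - 1"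
    using Suc.prems by auto
  moreover have "odd (2 ^ Suc m - 1 - y) = even y" "odd ((2::nat) ^ Suc m - 1)"
    using Suc.prems by auto
  moreover have "y div 2 < 2 ^ m"
    using Suc.prems by auto
  ultimately show ?case
    using Suc.IH[of "y div 2" "z div 2"] by simp
qed auto

lemma sum_walsh_left: "z < 2 ^ m \<Longrightarrow> (\<Sum>y<2 ^ m. walsh m y z) = 2 ^ m * of_bool (z = 0)"
  using walsh_orthogonal[of 0 m z] by auto

lemma sum_walsh_right: "x < 2 ^ m \<Longrightarrow> (\<Sum>y<2 ^ m. walsh m x y) = 2 ^ m * of_bool (x = 0)"
  using walsh_orthogonal[of x m 0] by auto

lemma card_walsh_signs:
  assumes "m \<ge> 1"
  shows "card {x. x < 2 ^ m \<and> walsh m (2 ^ m - 1) x = -1} = 2 ^ (m - 1)"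
    and "card {x. x < 2 ^ m \<and> x \<noteq> 0 \<and> walsh m (2 ^ m - 1) x \<noteq> -1} = 2 ^ (m - 1) - 1"
proof -
  let ?e = "walsh m (2 ^ m - 1)"
  define B where "B = {x. x < 2 ^ m \<and> ?e x = -1}"
  define C where "C = {x. x < 2 ^ m \<and> ?e x \<noteq> -1}"
  have fin: "finite B" "finite C" "B \<inter> C = {}" "B \<union> C = {..<2 ^ m}"
    by (auto simp: B_def C_def)
  have "(\<Sum>x<2 ^ m. ?e x) = (\<Sum>x\<in>B. ?e x) + (\<Sum>x\<in>C. ?e x)"
    using fin by (metis sum.union_disjoint)
  also have "(\<Sum>x\<in>B. ?e x) = (\<Sum>x\<in>B. -1)"
    by (rule sum.cong) (auto simp: B_def)
  also have "(\<Sum>x\<in>C. ?e x) = (\<Sum>x\<in>C. 1)"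
    using walsh_cases by (intro sum.cong) (auto simp: C_def)
  finally have "(\<Sum>x<2 ^ m. ?e x) = of_nat (card C) - of_nat (card B)"
    by simp
  \<comment> \<open>For \<open>m = 0\<close> the all-ones index would be \<open>0\<close>, and the
    signs would sum to \<open>1\<close> instead of \<open>0\<close>.\<close>
  moreover have "(2::nat) ^ m - 1 \<noteq> 0"
    using one_less_power[of "2::nat" m] assms by linarith
  ultimately have "card C = card B"
    using sum_walsh_right[of "2 ^ m - 1" m] by simp
  moreover have "card B + card C = 2 ^ m"
    using fin by (metis card_Un_disjoint card_lessThan)
  ultimately have *: "card B = 2 ^ (m - 1)" "card C = 2 ^ (m - 1)"
    using assms by (cases m; simp)+
  show "card {x. x < 2 ^ m \<and> ?e x = -1} = 2 ^ (m - 1)"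
    using * by (simp add: B_def)
  have "{x. x < 2 ^ m \<and> x \<noteq> 0 \<and> ?e x \<noteq> -1} = C - {0}" "0 \<in> C"
    by (auto simp: C_def)
  then show "card {x. x < 2 ^ m \<and> x \<noteq> 0 \<and> ?e x \<noteq> -1} = 2 ^ (m - 1) - 1"
    using * by simp
qed

section \<open>Counting tuples by entry type\<close>

text \<open>Entries come in three types: the single element outside \<open>P\<close>, the
  \<open>p\<close> elements of \<open>Q\<close>, and the \<open>r\<close> remaining elements of
  \<open>P\<close>. The formula places the \<open>P\<close> entries, then the \<open>Q\<close>
  entries among them, and then fills in values.\<close>

lemma card_lists_by_types:
  fixes P Q :: "'b \<Rightarrow> bool"
  assumes "finite S" and "\<And>x. x \<in> S \<Longrightarrow> Q x \<Longrightarrow> P x"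
    and "card {x \<in> S. \<not> P x} = 1" "card {x \<in> S. P x \<and> \<not> Q x} = r" "card {x \<in> S. Q x} = p"
  shows "card {u. length u = n \<and> set u \<subseteq> S \<and> length (filter P u) = i \<and> length (filter Q u) = t} =
    (n choose i) * (i choose t) * p ^ t * r ^ (i - t)"
proof -
  define L where "L n = {u. length u = n \<and> set u \<subseteq> S}" for n
  \<comment> \<open>Counting by a sum of indicators makes \<open>sum_lists_Suc\<close>
    applicable.\<close>
  define c where "c n i t = (\<Sum>u\<in>L n. of_bool (length (filter P u) = i \<and> length (filter Q u) = t) :: nat)"
    for n i t
  have fin: "finite (L n)" for n
    unfolding L_def using finite_lists_length_eq[OF assms(1), of n] by (simp add: conj_commute)
  have split: "(\<Sum>x\<in>S. if \<not> P x then a else if Q x then b else d) = a + p * b + r * d" for a b d :: nat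
  proof -
    have "(\<Sum>x\<in>S. if \<not> P x then a else if Q x then b else d) =
        (\<Sum>x\<in>S. (if \<not> P x then a else 0) + (if Q x then b else 0) + (if P x \<and> \<not> Q x then d else 0))"
      using assms(2) by (intro sum.cong) auto
    also have "\<dots> = a + p * b + r * d"
      using assms(3-5) by (simp add: sum.distrib assms(1) flip: sum.inter_filter)
    finally show ?thesis .
  qed
  \<comment> \<open>The three summands are the three types of the first entry; the conditionals
    guard against truncated subtraction.\<close>
  have rec: "c (Suc n) i t = c n i t +
      p * (if i = 0 \<or> t = 0 then 0 else c n (i - 1) (t - 1)) + r * (if i = 0 then 0 else c n (i - 1) t)"
    for n i t
    unfolding split[symmetric] unfolding c_def L_def sum_lists_Suc
    using assms(2) by (intro sum.cong refl) (auto intro!: sum.cong)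
  have main: "c n i t = (n choose i) * (i choose t) * p ^ t * r ^ (i - t)"
  proof (induction n arbitrary: i t)
    case 0
    have "L 0 = {[]}" by (auto simp: L_def)
    then show ?case by (cases i; cases t) (auto simp: c_def)
  next
    case (Suc n)
    show ?case
    proof (cases i)
      case 0
      then show ?thesis by (cases t) (simp_all add: rec Suc.IH)
    next
      case (Suc j)
      show ?thesis
      proof (cases t)
        case 0
        then show ?thesis using \<open>i = Suc j\<close> by (simp add: rec Suc.IH algebra_simps)
      next
        case (Suc s)
        \<comment> \<open>Only in the last case does \<open>r ^ (i - t)\<close> release a factor
          \<open>r\<close>; in the others \<open>j choose Suc s\<close> vanishes.\<close>
        consider "j < s" | "j = s" | l where "j = Suc (s + l)"
          by (metis add_Suc_right less_imp_Suc_add linorder_neqE_nat)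
        then show ?thesis
        proof cases
        qed (use \<open>i = Suc j\<close> \<open>t = Suc s\<close> in \<open>simp_all add: rec Suc.IH algebra_simps\<close>)
      qed
    qed
  qed
  have "{u. length u = n \<and> set u \<subseteq> S \<and> length (filter P u) = i \<and> length (filter Q u) = t} =
      L n \<inter> {u. length (filter P u) = i \<and> length (filter Q u) = t}"
    by (auto simp: L_def)
  then show ?thesis
    using main fin by (simp add: c_def sum_of_bool_eq)
qed

section \<open>Eigenvectors of the extended Hamming graph\<close>

text \<open>Vertices serve both as points and as indices of characters, so the character table is a
  square matrix over the vertex set.\<close>

definition character :: "nat \<Rightarrow> nat list \<Rightarrow> nat list \<Rightarrow> complex" where
  "character n u v = (\<Prod>k<n. walsh n (u ! k) (v ! k))"

lemma nth_hamming_verts: "u \<in> hamming_verts n \<Longrightarrow> k < n \<Longrightarrow> u ! k < 2 ^ n"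
  by (auto simp: hamming_verts_def dest!: nth_mem)

lemma length_hamming_verts: "u \<in> hamming_verts n \<Longrightarrow> length u = n"
  by (simp add: hamming_verts_def)

lemma finite_hamming_verts: "finite (hamming_verts n)"
  using finite_lists_length_eq[of "{0..<2 ^ n::nat}" n] by (simp add: hamming_verts_def conj_commute)

lemma character_orthogonal:
  assumes "u \<in> hamming_verts n" "w \<in> hamming_verts n"
  shows "(\<Sum>v\<in>hamming_verts n. character n u v * character n v w) = (2 ^ n) ^ n * of_bool (u = w)"
proof -
  have "(\<Sum>v\<in>hamming_verts n. character n u v * character n v w) =
      (\<Prod>k<n. \<Sum>x\<in>{0..<2 ^ n}. walsh n (u ! k) x * walsh n x (w ! k))"
    unfolding hamming_verts_def character_def prod.distrib[symmetric] by (rule sum_lists_prod)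
  also have "\<dots> = (\<Prod>k<n. 2 ^ n * of_bool (u ! k = w ! k))"
    using assms by (intro prod.cong refl)
      (simp add: nth_hamming_verts walsh_orthogonal atLeast0LessThan)
  also have "\<dots> = (2 ^ n) ^ n * of_bool (\<forall>k<n. u ! k = w ! k)"
    by (auto simp: prod.distrib)
  also have "(\<forall>k<n. u ! k = w ! k) \<longleftrightarrow> u = w"
    using assms by (auto simp: length_hamming_verts list_eq_iff_nth_eq)
  finally show ?thesis .
qed

text \<open>Parametrizing neighbours by the changed position and its new value turns a neighbour sum
  into a double sum.\<close>

lemma hamming_neighbours:
  assumes "u \<in> hamming_verts n"
  shows "{v \<in> hamming_verts n. card {k. k < n \<and> u ! k \<noteq> v ! k} = 1} =
    (\<lambda>(k, y). u[k := y]) ` (SIGMA k:{..<n}. {..<2 ^ n} - {u ! k})"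
proof (intro equalityI subsetI)
  fix v assume v: "v \<in> {v \<in> hamming_verts n. card {k. k < n \<and> u ! k \<noteq> v ! k} = 1}"
  then obtain k where k: "{k. k < n \<and> u ! k \<noteq> v ! k} = {k}"
    by (auto simp: card_1_singleton_iff)
  then have k_lt: "k < n" "u ! k \<noteq> v ! k" by auto
  have "v = u[k := v ! k]"
  proof (rule nth_equalityI)
    fix j assume "j < length v"
    then have "j < n" using v by (auto simp: length_hamming_verts)
    moreover have "u ! j = v ! j" if "j \<noteq> k"
      using k that \<open>j < n\<close> by blast
    ultimately show "v ! j = u[k := v ! k] ! j"
      by (simp add: nth_list_update length_hamming_verts[OF assms] k_lt)
  qed (use v assms in \<open>auto simp: length_hamming_verts\<close>)
  then show "v \<in> (\<lambda>(k, y). u[k := y]) ` (SIGMA k:{..<n}. {..<2 ^ n} - {u ! k})"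
    using k_lt v by (intro image_eqI[of _ _ "(k, v ! k)"]) (auto intro: nth_hamming_verts)
next
  fix v assume "v \<in> (\<lambda>(k, y). u[k := y]) ` (SIGMA k:{..<n}. {..<2 ^ n} - {u ! k})"
  then obtain k y where v: "k < n" "y < 2 ^ n" "y \<noteq> u ! k" "v = u[k := y]"
    by auto
  have "{j. j < n \<and> u ! j \<noteq> v ! j} = {k}"
    using v assms by (auto simp: length_hamming_verts nth_list_update)
  moreover have "v \<in> hamming_verts n"
    using v assms set_update_subset_insert[of u k y] by (auto simp: hamming_verts_def)
  ultimately show "v \<in> {v \<in> hamming_verts n. card {k. k < n \<and> u ! k \<noteq> v ! k} = 1}"
    by simp
qed

text \<open>Since \<open>y\<close> differs from \<open>u ! k\<close>, the updated list reveals
  \<open>k\<close> as the only place where it differs from \<open>u\<close>.\<close>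

lemma inj_on_hamming_neighbours:
  assumes "u \<in> hamming_verts n"
  shows "inj_on (\<lambda>(k, y). u[k := y]) (SIGMA k:{..<n}. {..<2 ^ n} - {u ! k})"
proof -
  have key: "j = k \<and> x = y"
    if *: "j < n" "x \<noteq> u ! j" "k < n" "y \<noteq> u ! k" "u[j := x] = u[k := y]" for j x k y
  proof -
    have len: "length u = n" using assms by (rule length_hamming_verts)
    have "j = k"
      using * len by (metis nth_list_update_eq nth_list_update_neq)
    then show "j = k \<and> x = y"
      using * len by (metis nth_list_update_eq)
  qed
  show ?thesis
  proof (rule inj_onI)
    fix p q assume "p \<in> (SIGMA k:{..<n}. {..<2 ^ n} - {u ! k})" "q \<in> (SIGMA k:{..<n}. {..<2 ^ n} - {u ! k})"
      "(\<lambda>(k, y). u[k := y]) p = (\<lambda>(k, y). u[k := y]) q"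
    then show "p = q"
      using key[of "fst p" "snd p" "fst q" "snd q"] by (auto simp: prod_eq_iff case_prod_unfold)
  qed
qed

text \<open>One coordinate acts as a complete graph on \<open>2 ^ m\<close> points, with eigenvalue
  \<open>2 ^ m - 1\<close> on the constant function and \<open>-1\<close> on the other Walsh
  functions.\<close>

lemma sum_walsh_others:
  assumes "x < 2 ^ m" "z < 2 ^ m"
  shows "(\<Sum>y\<in>{..<2 ^ m} - {x}. walsh m y z) = (2 ^ m * of_bool (z = 0) - 1) * walsh m x z"
proof -
  have "(\<Sum>y\<in>{..<2 ^ m} - {x}. walsh m y z) = 2 ^ m * of_bool (z = 0) - walsh m x z"
    using assms by (simp add: sum_diff1 sum_walsh_left)
  then show ?thesis
    by (cases "z = 0") simp_all
qed

lemma character_update: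
  assumes "length u = n" "k < n"
  shows "character n (u[k := y]) w = walsh n y (w ! k) * (\<Prod>j\<in>{..<n} - {k}. walsh n (u ! j) (w ! j))"
  using assms unfolding character_def
  by (subst prod.remove[of _ k]) (auto intro!: prod.cong)

text \<open>Changing coordinate \<open>k\<close> contributes \<open>2 ^ n - 1\<close> if
  \<open>w ! k = 0\<close> and \<open>-1\<close> otherwise; the eigenvalue is the sum over all
  \<open>k\<close>.\<close>

lemma hamming_eigenvector:
  assumes u: "u \<in> hamming_verts n" and w: "w \<in> hamming_verts n"
  shows "(\<Sum>v\<in>hamming_verts n.
      of_bool (card {k. k < n \<and> u ! k \<noteq> v ! k} = 1) * character n v w) =
    hamming_ev n (length (filter (\<lambda>x. x \<noteq> 0) w)) * character n u w"
proof -
  let ?rest = "\<lambda>k. \<Prod>j\<in>{..<n} - {k}. walsh n (u ! j) (w ! j)"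
  have "(\<Sum>v\<in>hamming_verts n.
      of_bool (card {k. k < n \<and> u ! k \<noteq> v ! k} = 1) * character n v w) =
    (\<Sum>v\<in>{v \<in> hamming_verts n. card {k. k < n \<and> u ! k \<noteq> v ! k} = 1}. character n v w)"
    by (subst sum.inter_filter[OF finite_hamming_verts]) (auto intro!: sum.cong)
  also have "\<dots> = (\<Sum>(k, y)\<in>(SIGMA k:{..<n}. {..<2 ^ n} - {u ! k}). character n (u[k := y]) w)"
    unfolding hamming_neighbours[OF u]
    by (subst sum.reindex[OF inj_on_hamming_neighbours[OF u]]) (simp add: case_prod_unfold)
  also have "\<dots> = (\<Sum>k<n. \<Sum>y\<in>{..<2 ^ n} - {u ! k}. character n (u[k := y]) w)"
    by (simp add: sum.Sigma)
  also have "\<dots> = (\<Sum>k<n. (2 ^ n * of_bool (w ! k = 0) - 1) * character n u w)"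
  proof (rule sum.cong)
    fix k assume k: "k \<in> {..<n}"
    have "(\<Sum>y\<in>{..<2 ^ n} - {u ! k}. character n (u[k := y]) w) =
        (\<Sum>y\<in>{..<2 ^ n} - {u ! k}. walsh n y (w ! k)) * ?rest k"
      using k by (simp add: character_update length_hamming_verts[OF u] sum_distrib_right)
    also have "\<dots> = (2 ^ n * of_bool (w ! k = 0) - 1) * (walsh n (u ! k) (w ! k) * ?rest k)"
      using k u w by (simp add: sum_walsh_others nth_hamming_verts)
    also have "walsh n (u ! k) (w ! k) * ?rest k = character n u w"
      unfolding character_def using k by (intro prod.remove[symmetric]) simp_all
    finally show "(\<Sum>y\<in>{..<2 ^ n} - {u ! k}. character n (u[k := y]) w) =
      (2 ^ n * of_bool (w ! k = 0) - 1) * character n u w" .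
  qed simp
  also have "\<dots> = (2 ^ n * of_nat (card {k. k < n \<and> w ! k = 0}) - of_nat n) * character n u w"
    by (simp add: sum_subtractf lessThan_def Int_def flip: sum_distrib_left sum_distrib_right)
  also have "card {k. k < n \<and> w ! k = 0} = length (filter (\<lambda>x. x = 0) w)"
    by (simp add: length_filter_conv_card length_hamming_verts[OF w])
  \<comment> \<open>The sum has counted zero entries, while \<open>hamming_ev\<close> is indexed by
    the nonzero ones.\<close>
  also have "\<dots> = n - length (filter (\<lambda>x. x \<noteq> 0) w)"
    using sum_length_filter_compl[of "\<lambda>x. x = 0" w] by (simp add: length_hamming_verts[OF w])
  also have "of_nat \<dots> = of_nat n - (of_nat (length (filter (\<lambda>x. x \<noteq> 0) w)) :: complex)"
    using length_filter_le[of _ w] by (subst of_nat_diff) (auto simp: length_hamming_verts[OF w])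
  finally show ?thesis
    by (simp add: hamming_ev_def)
qed

lemma compl_vert_in_hamming_verts: "u \<in> hamming_verts n \<Longrightarrow> compl_vert n u \<in> hamming_verts n"
  by (auto simp: hamming_verts_def compl_vert_def less_imp_diff_less)

lemma compl_vert_compl_vert: "u \<in> hamming_verts n \<Longrightarrow> compl_vert n (compl_vert n u) = u"
  by (auto simp: hamming_verts_def compl_vert_def intro!: map_idI)

lemma compl_vert_nth_neq:
  assumes "u \<in> hamming_verts n" "k < n"
  shows "compl_vert n u ! k \<noteq> u ! k"
proof
  assume "compl_vert n u ! k = u ! k"
  then have "2 ^ n - 1 - u ! k = u ! k"
    using assms by (simp add: compl_vert_def length_hamming_verts)
  then have "2 ^ n = 2 * (u ! k) + 1"
    using nth_hamming_verts[OF assms] by linarith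
  \<comment> \<open>Here \<open>k < n\<close> supplies \<open>n > 0\<close>.\<close>
  moreover have "even (2 ^ n :: nat)"
    using assms by simp
  ultimately show False by simp
qed

lemma prod_list_signs:
  assumes "\<And>x. x \<in> set xs \<Longrightarrow> f x = 1 \<or> f x = (-1 :: complex)"
  shows "(\<Prod>x\<leftarrow>xs. f x) = (-1) ^ length (filter (\<lambda>x. f x = -1) xs)"
  using assms by (induction xs) auto

text \<open>By \<open>walsh_compl\<close>, complementing \<open>u\<close> pulls one sign out of each
  coordinate, depending only on the entry of \<open>w\<close> there.\<close>

lemma compl_eigenvector:
  assumes u: "u \<in> hamming_verts n" and w: "w \<in> hamming_verts n"
  shows "(\<Sum>v\<in>hamming_verts n. of_bool (v = compl_vert n u) * character n v w) =
    (-1) ^ length (filter (\<lambda>x. walsh n (2 ^ n - 1) x = -1) w) * character n u w"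
proof -
  have "(\<Sum>v\<in>hamming_verts n. of_bool (v = compl_vert n u) * character n v w) =
      character n (compl_vert n u) w"
    using compl_vert_in_hamming_verts[OF u] finite_hamming_verts
    by (simp add: of_bool_def if_distrib[of "\<lambda>x. x * _"] cong: if_cong)
  also have "\<dots> = (\<Prod>k<n. walsh n (2 ^ n - 1) (w ! k) * walsh n (u ! k) (w ! k))"
    unfolding character_def
    using walsh_compl[OF nth_hamming_verts[OF u]]
    by (intro prod.cong) (auto simp: compl_vert_def length_hamming_verts[OF u])
  also have "\<dots> = (\<Prod>x\<leftarrow>w. walsh n (2 ^ n - 1) x) * character n u w"
    using prod.list_conv_set_nth[of "map (walsh n (2 ^ n - 1)) w"]
    by (simp add: prod.distrib character_def length_hamming_verts[OF w] atLeast0LessThan)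
  also have "(\<Prod>x\<leftarrow>w. walsh n (2 ^ n - 1) x) =
      (-1) ^ length (filter (\<lambda>x. walsh n (2 ^ n - 1) x = -1) w)"
    by (rule prod_list_signs) (rule walsh_cases)
  finally show ?thesis .
qed

section \<open>Edges and adjacency matrices\<close>

lemma hamming_edge_iff:
  assumes "u \<in> hamming_verts n" "v \<in> hamming_verts n"
  shows "{u, v} \<in> hamming_edges n \<longleftrightarrow> card {k. k < n \<and> u ! k \<noteq> v ! k} = 1"
proof -
  have "card {k. k < n \<and> v ! k \<noteq> u ! k} = card {k. k < n \<and> u ! k \<noteq> v ! k}"
    by (simp add: eq_commute)
  then show ?thesis
    using assms by (auto simp: hamming_edges_def doubleton_eq_iff)
qed

text \<open>Complementation is an involution, so both orientations of an edge agree. For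
  \<open>n = 0\<close> the empty tuple would be its own complement.\<close>

lemma compl_edge_iff:
  assumes "n \<ge> 1" "u \<in> hamming_verts n" "v \<in> hamming_verts n"
  shows "{u, v} \<in> compl_edges n \<longleftrightarrow> v = compl_vert n u"
proof -
  have "u \<noteq> compl_vert n u"
    using compl_vert_nth_neq[OF assms(2), of 0] assms(1) by auto
  then show ?thesis
    using assms compl_vert_compl_vert by (auto simp: compl_edges_def doubleton_eq_iff)
qed

lemma compl_vert_distance:
  assumes "u \<in> hamming_verts n"
  shows "card {k. k < n \<and> u ! k \<noteq> compl_vert n u ! k} = n"
proof -
  have "{k. k < n \<and> u ! k \<noteq> compl_vert n u ! k} = {..<n}"
    using compl_vert_nth_neq[OF assms] by force
  then show ?thesis by simp
qed

lemma finite_hamming_edges: "finite (hamming_edges n)"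
  by (rule finite_subset[of _ "Pow (hamming_verts n)"])
    (auto simp: hamming_edges_def finite_hamming_verts)

lemma finite_compl_edges: "finite (compl_edges n)"
  by (rule finite_subset[of _ "Pow (hamming_verts n)"])
    (auto simp: compl_edges_def finite_hamming_verts compl_vert_in_hamming_verts)

lemma count_ext_hamming_multi_edges:
  assumes "n \<ge> 1" "u \<in> hamming_verts n" "v \<in> hamming_verts n"
  shows "count (ext_hamming_multi_edges n) {u, v} =
    of_bool (card {k. k < n \<and> u ! k \<noteq> v ! k} = 1) + of_bool (v = compl_vert n u)"
  unfolding ext_hamming_multi_edges_def count_union
    count_mset_set' hamming_edge_iff[OF assms(2,3)] compl_edge_iff[OF assms]
  by (simp only: finite_hamming_edges finite_compl_edges of_bool_def simp_thms)

text \<open>Complementary vertices differ in all \<open>n\<close> positions, and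
  \<open>n \<noteq> 1\<close>, so no pair is an edge of both families.\<close>

lemma ext_hamming_edge_iff:
  assumes "n \<ge> 2" "u \<in> hamming_verts n" "v \<in> hamming_verts n"
  shows "of_bool ({u, v} \<in> ext_hamming_edges n) = count (ext_hamming_multi_edges n) {u, v}"
proof -
  have n: "n \<ge> 1" using assms(1) by simp
  have "\<not> (card {k. k < n \<and> u ! k \<noteq> v ! k} = 1 \<and> v = compl_vert n u)"
    using compl_vert_distance[OF assms(2)] assms(1) by auto
  then show ?thesis
    unfolding count_ext_hamming_multi_edges[OF n assms(2,3)] ext_hamming_edges_def Un_iff
      hamming_edge_iff[OF assms(2,3)] compl_edge_iff[OF n assms(2,3)]
    by (simp only: of_bool_def split: if_split) simp
qed

lemma multigraph_adj_mat_ext_hamming: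
  assumes "n \<ge> 1" "set vs = hamming_verts n"
  shows "multigraph_adj_mat vs (ext_hamming_multi_edges n) =
    mat (length vs) (length vs) (\<lambda>(i, j).
      of_bool (card {k. k < n \<and> vs ! i ! k \<noteq> vs ! j ! k} = 1) + of_bool (vs ! j = compl_vert n (vs ! i)))"
proof -
  have "complex_of_nat (count (ext_hamming_multi_edges n) {vs ! i, vs ! j}) =
      of_bool (card {k. k < n \<and> vs ! i ! k \<noteq> vs ! j ! k} = 1) + of_bool (vs ! j = compl_vert n (vs ! i))"
    if "i < length vs" "j < length vs" for i j
  proof -
    have "vs ! i \<in> hamming_verts n" "vs ! j \<in> hamming_verts n"
      using that by (simp_all flip: assms(2))
    then show ?thesis
      by (simp only: count_ext_hamming_multi_edges[OF assms(1)] of_nat_add of_nat_of_bool)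
  qed
  then show ?thesis
    by (intro eq_matI) (simp_all add: multigraph_adj_mat_def)
qed

lemma graph_adj_mat_ext_hamming:
  assumes "n \<ge> 2" "set vs = hamming_verts n"
  shows "graph_adj_mat vs (ext_hamming_edges n) = multigraph_adj_mat vs (ext_hamming_multi_edges n)"
proof -
  have "(if {vs ! i, vs ! j} \<in> ext_hamming_edges n then 1 else 0) =
      complex_of_nat (count (ext_hamming_multi_edges n) {vs ! i, vs ! j})"
    if "i < length vs" "j < length vs" for i j
  proof -
    have "vs ! i \<in> hamming_verts n" "vs ! j \<in> hamming_verts n"
      using that by (simp_all flip: assms(2))
    then show ?thesis
      by (simp flip: ext_hamming_edge_iff[OF assms(1)])
  qed
  then show ?thesis
    by (intro eq_matI) (simp_all add: graph_adj_mat_def multigraph_adj_mat_def)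
qed

section \<open>Spectrum and multiplicities\<close>

lemma mat_spectrum_ext_hamming:
  assumes "n \<ge> 1" "distinct vs" "set vs = hamming_verts n"
  shows "mat_spectrum (multigraph_adj_mat vs (ext_hamming_multi_edges n)) =
    image_mset (\<lambda>w. ext_hamming_ev n (length (filter (\<lambda>x. x \<noteq> 0) w))
      (length (filter (\<lambda>x. walsh n (2 ^ n - 1) x = -1) w))) (mset_set (hamming_verts n))"
proof -
  let ?\<theta> = "\<lambda>w. ext_hamming_ev n (length (filter (\<lambda>x. x \<noteq> 0) w))
      (length (filter (\<lambda>x. walsh n (2 ^ n - 1) x = -1) w))"
  have "char_poly (multigraph_adj_mat vs (ext_hamming_multi_edges n)) = (\<Prod>w\<leftarrow>vs. [:- ?\<theta> w, 1:])"
    unfolding multigraph_adj_mat_ext_hamming[OF assms(1,3)]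
  \<comment> \<open>By \<open>character_orthogonal\<close> the character table is inverse to itself
    up to the factor \<open>(2 ^ n) ^ n\<close>.\<close>
  proof (rule char_poly_eigenbasis[where p = "character n"
        and q = "\<lambda>v w. character n v w / (2 ^ n) ^ n"])
    fix u w assume uw: "u \<in> set vs" "w \<in> set vs"
    show "(\<Sum>v\<in>set vs. character n u v * (character n v w / (2 ^ n) ^ n)) = of_bool (u = w)"
      using uw character_orthogonal[of u n w]
      by (simp add: assms(3) flip: sum_divide_distrib)
    show "(\<Sum>v\<in>set vs. (of_bool (card {k. k < n \<and> u ! k \<noteq> v ! k} = 1) + of_bool (v = compl_vert n u)) *
        character n v w) = ?\<theta> w * character n u w"
      using uw by (simp only: assms(3) distrib_right sum.distrib hamming_eigenvector compl_eigenvector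
          ext_hamming_ev_def)
  qed fact
  then show ?thesis
    by (simp add: mat_spectrum_def proots_prod_linear_factors mset_set_set[OF assms(2)] flip: assms(3))
qed

text \<open>Groups the elements by the pair \<open>(f u, g u)\<close>; the bounds place every pair
  in the triangular index range.\<close>

lemma image_mset_by_types:
  fixes F :: "nat \<Rightarrow> nat \<Rightarrow> 'c" and A :: "'a set"
  assumes "finite A" and "\<And>u. u \<in> A \<Longrightarrow> f u \<le> n" and "\<And>u. u \<in> A \<Longrightarrow> g u \<le> f u"
  shows "image_mset (\<lambda>u. F (f u) (g u)) (mset_set A) =
    (\<Sum>i\<in>{0..n}. \<Sum>t\<in>{0..i}. replicate_mset (card {u \<in> A. f u = i \<and> g u = t}) (F i t))"
proof -
  have "image_mset (\<lambda>u. F (f u) (g u)) (mset_set A) = (\<Sum>u\<in>A. {#F (f u) (g u)#})"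
    using assms(1) by (induction A) auto
  also have "\<dots> = (\<Sum>p\<in>(SIGMA i:{0..n}. {0..i}). \<Sum>u\<in>{u \<in> A. (f u, g u) = p}. {#F (f u) (g u)#})"
    using assms by (intro sum.group[symmetric]) auto
  also have "\<dots> = (\<Sum>(i, t)\<in>(SIGMA i:{0..n}. {0..i}). \<Sum>u\<in>{u \<in> A. f u = i \<and> g u = t}. {#F i t#})"
    by (intro sum.cong refl) auto
  also have "\<dots> = (\<Sum>i\<in>{0..n}. \<Sum>t\<in>{0..i}. \<Sum>u\<in>{u \<in> A. f u = i \<and> g u = t}. {#F i t#})"
    by (rule sum.Sigma[symmetric]) auto
  also have "\<dots> = (\<Sum>i\<in>{0..n}. \<Sum>t\<in>{0..i}. replicate_mset (card {u \<in> A. f u = i \<and> g u = t}) (F i t))"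
  proof -
    have "(\<Sum>u\<in>B. {#x#}) = replicate_mset (card B) x" if "finite B" for B :: "'a set" and x :: 'c
      using that by (induction B) auto
    then show ?thesis using assms(1) by simp
  qed
  finally show ?thesis .
qed

lemma card_hamming_verts_by_types:
  assumes "n \<ge> 1"
  shows "card {w \<in> hamming_verts n. length (filter (\<lambda>x. x \<noteq> 0) w) = i \<and>
      length (filter (\<lambda>x. walsh n (2 ^ n - 1) x = -1) w) = t} = ext_hamming_mult n i t"
proof -
  let ?e = "walsh n (2 ^ n - 1)"
  have "card {w. length w = n \<and> set w \<subseteq> {0..<2 ^ n} \<and> length (filter (\<lambda>x. x \<noteq> 0) w) = i \<and>
      length (filter (\<lambda>x. ?e x = -1) w) = t} =
    (n choose i) * (i choose t) * (2 ^ (n - 1)) ^ t * (2 ^ (n - 1) - 1) ^ (i - t)"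
  proof (rule card_lists_by_types)
    have "{x \<in> {0..<2 ^ n}. \<not> x \<noteq> 0} = {0 :: nat}"
      by auto
    then show "card {x \<in> {0..<2 ^ n}. \<not> x \<noteq> (0 :: nat)} = 1"
      by simp
    \<comment> \<open>The index \<open>0\<close> has sign \<open>1\<close> by
      \<open>walsh_0_right\<close>.\<close>
    show "x \<noteq> 0" if "?e x = -1" for x
      using that by (auto intro: ccontr)
    show "card {x \<in> {0..<2 ^ n}. x \<noteq> 0 \<and> ?e x \<noteq> -1} = 2 ^ (n - 1) - 1"
      "card {x \<in> {0..<2 ^ n}. ?e x = -1} = 2 ^ (n - 1)"
      using card_walsh_signs[OF assms] by simp_all
  qed simp
  then show ?thesis
    by (simp add: hamming_verts_def ext_hamming_mult_def power_mult conj_assoc)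
qed

text \<open>For \<open>n = 1\<close> the formula gives the eigenvalues \<open>2\<close> and
  \<open>-2\<close> of a double edge, whereas the simple graph has \<open>1\<close> and
  \<open>-1\<close>. Hence the simple graph is treated for \<open>n \<ge> 2\<close> and the
  multigraph for all \<open>n \<ge> 1\<close>.\<close>

theorem theorem4p5:
  fixes n :: nat and vs :: "nat list list"
  assumes "n \<ge> 1"
    and "distinct vs" and "set vs = hamming_verts n"
  shows "(n \<ge> 2 \<longrightarrow>
      mat_spectrum (graph_adj_mat vs (ext_hamming_edges n)) =
        (\<Sum>i\<in>{0..n}. \<Sum>t\<in>{0..i}. replicate_mset (ext_hamming_mult n i t) (ext_hamming_ev n i t))) \<and>
    mat_spectrum (multigraph_adj_mat vs (ext_hamming_multi_edges n)) =
        (\<Sum>i\<in>{0..n}. \<Sum>t\<in>{0..i}. replicate_mset (ext_hamming_mult n i t) (ext_hamming_ev n i t))"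
proof -
  let ?nonzero = "\<lambda>w :: nat list. length (filter (\<lambda>x. x \<noteq> 0) w)"
  let ?neg = "\<lambda>w. length (filter (\<lambda>x. walsh n (2 ^ n - 1) x = -1) w)"
  \<comment> \<open>Entries of sign \<open>-1\<close> are nonzero, which gives the range
    \<open>t \<le> i\<close>.\<close>
  have "?neg w \<le> ?nonzero w" for w
    by (induction w) auto
  moreover have "?nonzero w \<le> n" if "w \<in> hamming_verts n" for w
    using length_filter_le[of _ w] that by (simp add: length_hamming_verts)
  ultimately have "mat_spectrum (multigraph_adj_mat vs (ext_hamming_multi_edges n)) =
      (\<Sum>i\<in>{0..n}. \<Sum>t\<in>{0..i}. replicate_mset (ext_hamming_mult n i t) (ext_hamming_ev n i t))"
    unfolding mat_spectrum_ext_hamming[OF assms] card_hamming_verts_by_types[OF assms(1), symmetric]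
    by (intro image_mset_by_types finite_hamming_verts)
  then show ?thesis
    using graph_adj_mat_ext_hamming[OF _ assms(3)] by simp
qed

end
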